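(* As power series in $q$, $$\sum_{n=0}^{\infty}a^{o}_{ed}(n)q^n=\frac{(-q^2;q^2)_{\infty}}{(q;q^2)_{\infty}}\left(\sum_{n=0}^{\infty}\frac{q^{2n^2+n}}{(-q^2;q^2)_n}-\sum_{n=0}^{\infty}\frac{q^{(2n+1)(n+1)}}{(-q^2;q^2)_n}\right)$$ and $$\sum_{n=0}^{\infty}a^{e}_{ed}(n)q^n=\frac{(-q^2;q^2)_{\infty}}{(q;q^2)_{\infty}}\sum_{n=0}^{\infty}\frac{q^{2n^2-n}}{(-q^2;q^2)_n}.$$
   Context: Notation: $(a;q)_0:=1$, $(a;q)_n:=\prod_{k=0}^{n-1}(1-aq^k)$, $(a;q)_\infty:=\lim_{n\to\infty}(a;q)_n$. For $n\ge 0$, $\mathcal{P}_{ed}(n)$ is the set of all partitions of $n$ in which no even part is repeated (each even part appears at most once; odd parts may appear with any multiplicity). The empty partition is the unique element of $\mathcal{P}_{ed}(0)$. For a partition $\lambda$, $\mathrm{mex}(\lambda)$ is the smallest positive integer that is not a part of $\lambda$. Define $$a^{o}_{ed}(n):=\#\{\lambda\in\mathcal{P}_{ed}(n): \mathrm{mex}(\lambda)\equiv 1 \pmod 2\},\qquad a^{e}_{ed}(n):=\#\{\lambda\in\mathcal{P}_{ed}(n): \mathrm{mex}(\lambda)\equiv 0 \pmod 2\}.$$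
   Formalization: In the second identity the sum on the right starts at n = 1 instead of n = 0; as printed it fails, since its right-hand side has constant coefficient 1 while a^e_ed(0) = 0 (the empty partition has mex 1). *)

theory Defs
  imports
    "HOL-Library.Multiset"
    "HOL-Computational_Algebra.Formal_Power_Series"
begin

definition q_poch :: "'a::comm_ring_1 \<Rightarrow> 'a \<Rightarrow> nat \<Rightarrow> 'a" where
  "q_poch a q n = (\<Prod>k<n. 1 - a * q ^ k)"

text \<open>For formal power series the limit is taken in the library's \<open>X\<close>-adic metric.\<close>

definition q_poch_inf :: "'a::{comm_ring_1,t2_space} \<Rightarrow> 'a \<Rightarrow> 'a" where
  "q_poch_inf a q = lim (\<lambda>n. q_poch a q n)"

text \<open>Partitions of \<open>n\<close> are finite multisets of positive integers with sum \<open>n\<close>.\<close>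

definition partitions_ed :: "nat \<Rightarrow> nat multiset set" where
  "partitions_ed n =
     {p. 0 \<notin># p \<and> sum_mset p = n \<and> (\<forall>k. even k \<longrightarrow> count p k \<le> 1)}"

definition mex :: "nat multiset \<Rightarrow> nat" where
  "mex p = (LEAST m. 0 < m \<and> m \<notin># p)"

definition a_ed_odd :: "nat \<Rightarrow> nat" where
  "a_ed_odd n = card {p \<in> partitions_ed n. odd (mex p)}"

definition a_ed_even :: "nat \<Rightarrow> nat" where
  "a_ed_even n = card {p \<in> partitions_ed n. even (mex p)}"

text \<open>
  Deviation from the source, which sums \<open>q^(2n^2 - n) / (-q^2; q^2)_n\<close> over \<open>n \<ge> 0\<close> in the
  identity for even mex.  That identity is false: its right-hand side has constant coefficient 1,
  whereas \<open>a_ed_even 0 = 0\<close> because the empty partition has mex 1.  The \<open>n\<close>-th summand accounts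
  for the partitions with mex \<open>2n\<close>, so the sum has to start at \<open>n = 1\<close>; the theorem is stated
  with this correction, as a sum over \<open>Suc n\<close>.
\<close>

end

theory Submission
  imports Defs
begin

text \<open>
  Fixing \<open>mex p = m\<close> prescribes for each part \<open>k\<close> independently which multiplicities are allowed:
  positive below \<open>m\<close>, zero at \<open>m\<close>, unrestricted above, always at most one for even \<open>k\<close>.  So the
  generating function is a product over \<open>k\<close>, differing from the product \<open>(-q^2; q^2) / (q; q^2)\<close>
  for all partitions without repeated even parts in finitely many factors: below \<open>m\<close> there is
  an extra \<open>q^k / (1 + q^k)\<close> for even and \<open>q^k\<close> for odd \<open>k\<close>, and the factor at \<open>m\<close> is cancelled.
  Summing over odd or even \<open>m\<close> gives the two identities.  Infinite products are handled as limits of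
  the products over \<open>k \<le> 2K\<close>, whose \<open>n\<close>-th coefficients are constant once
  \<open>K \<ge> n + m\<close>.
\<close>

unbundle fps_syntax

section \<open>The topology of formal power series\<close>

text \<open>Convergence means that every coefficient is eventually constant, and coefficient
  \<open>n\<close> of a product involves only the finitely many coefficients up to \<open>n\<close>
  of its factors.\<close>

lemma tendsto_mult_fps:
  fixes f g :: "'b \<Rightarrow> 'a::ring fps"
  assumes "(f \<longlongrightarrow> F) net" and "(g \<longlongrightarrow> G) net"
  shows "((\<lambda>x. f x * g x) \<longlongrightarrow> F * G) net"
proof (rule tendsto_fpsI)
  fix n
  have "\<forall>\<^sub>F x in net. \<forall>i\<in>{..n}. f x $ i = F $ i"
    using assms(1) by (intro eventually_ball_finite) (auto simp: tendsto_fps_iff)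
  moreover have "\<forall>\<^sub>F x in net. \<forall>i\<in>{..n}. g x $ i = G $ i"
    using assms(2) by (intro eventually_ball_finite) (auto simp: tendsto_fps_iff)
  ultimately show "\<forall>\<^sub>F x in net. (f x * g x) $ n = (F * G) $ n"
    by eventually_elim (auto simp: fps_mult_nth)
qed

lemma tendsto_diff_fps:
  fixes f g :: "'b \<Rightarrow> 'a::ring fps"
  assumes "(f \<longlongrightarrow> F) net" and "(g \<longlongrightarrow> G) net"
  shows "((\<lambda>x. f x - g x) \<longlongrightarrow> F - G) net"
proof (rule tendsto_fpsI)
  fix n
  have "\<forall>\<^sub>F x in net. f x $ n = F $ n" "\<forall>\<^sub>F x in net. g x $ n = G $ n"
    using assms by (auto simp: tendsto_fps_iff)
  then show "\<forall>\<^sub>F x in net. (f x - g x) $ n = (F - G) $ n"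
    by eventually_elim auto
qed

lemma sums_mult_fps:
  fixes f :: "nat \<Rightarrow> 'a::ring fps"
  assumes "f sums s"
  shows "(\<lambda>n. c * f n) sums (c * s)"
  using tendsto_mult_fps[OF tendsto_const[of c] assms[unfolded sums_def]]
  by (simp add: sums_def sum_distrib_left)

lemma sums_diff_fps:
  fixes f g :: "nat \<Rightarrow> 'a::ring fps"
  assumes "f sums s" and "g sums t"
  shows "(\<lambda>n. f n - g n) sums (s - t)"
  using tendsto_diff_fps[OF assms[unfolded sums_def]]
  by (simp add: sums_def sum_subtractf)

text \<open>Coefficient \<open>i\<close> is settled from index \<open>Suc i\<close> on, so the limit
  is obtained by reading it off there.\<close>

lemma convergent_fpsI:
  fixes f :: "nat \<Rightarrow> 'a::group_add fps"
  assumes "\<And>n i. i < n \<Longrightarrow> f (Suc n) $ i = f n $ i"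
  shows "convergent f"
proof -
  have const: "f n $ i = f (Suc i) $ i" if "Suc i \<le> n" for n i
    using that by (induction n rule: dec_induct) (use assms in auto)
  have "f \<longlonglongrightarrow> Abs_fps (\<lambda>i. f (Suc i) $ i)"
  proof (rule tendsto_fpsI)
    fix i
    show "\<forall>\<^sub>F n in sequentially. f n $ i = Abs_fps (\<lambda>i. f (Suc i) $ i) $ i"
      unfolding fps_nth_Abs_fps by (rule eventually_sequentiallyI[of "Suc i"]) (rule const)
  qed
  then show ?thesis
    by (rule convergentI)
qed

lemma summable_fpsI:
  fixes f :: "nat \<Rightarrow> 'a::ab_group_add fps"
  assumes "\<And>n i. i < n \<Longrightarrow> f n $ i = 0"
  shows "summable f"
  unfolding summable_iff_convergent
  by (rule convergent_fpsI) (use assms in auto)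

lemma summable_fps_X_power_mult:
  fixes f :: "nat \<Rightarrow> 'a::comm_ring_1 fps"
  assumes "\<And>n. n \<le> e n"
  shows "summable (\<lambda>n. fps_X ^ e n * f n)"
  by (rule summable_fpsI) (use assms in \<open>auto simp: fps_X_power_mult_nth dest: less_le_trans\<close>)

section \<open>Infinite \<open>q\<close>-Pochhammer symbols\<close>

lemma q_poch_Suc: "q_poch a q (Suc n) = q_poch a q n * (1 - a * q ^ n)"
  by (simp add: q_poch_def)

lemma q_poch_fps_X_Suc:
  "q_poch fps_X (fps_X ^ 2) (Suc n) =
    q_poch fps_X (fps_X ^ 2) n * (1 - fps_X ^ (2 * n + 1) :: 'a::comm_ring_1 fps)"
  by (simp only: q_poch_Suc power_add flip: power_mult) (simp add: mult.commute)

lemma q_poch_neg_fps_X2_Suc: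
  "q_poch (- (fps_X ^ 2)) (fps_X ^ 2) (Suc n) =
    q_poch (- (fps_X ^ 2)) (fps_X ^ 2) n * (1 + fps_X ^ (2 * n + 2) :: 'a::comm_ring_1 fps)"
  by (simp only: q_poch_Suc power_add flip: power_mult) (simp add: mult.commute)

lemma q_poch_fps_nth_0:
  fixes a q :: "'a::comm_ring_1 fps"
  assumes "a $ 0 = 0"
  shows "q_poch a q n $ 0 = 1"
  using assms by (induction n) (simp_all add: q_poch_Suc, simp add: q_poch_def)

lemma q_poch_LIMSEQ:
  fixes a :: "'a::comm_ring_1 fps"
  shows "q_poch a (fps_X ^ 2) \<longlonglongrightarrow> q_poch_inf a (fps_X ^ 2)"
proof -
  have "convergent (q_poch a (fps_X ^ 2))"
  proof (rule convergent_fpsI)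
    fix n i :: nat
    assume "i < n"
    \<comment> \<open>The new factor changes the product only by a multiple of
      \<open>fps_X ^ (2 * n)\<close>, which coefficients below \<open>n\<close> do not see.\<close>
    have "q_poch a (fps_X ^ 2) (Suc n) =
      q_poch a (fps_X ^ 2) n - fps_X ^ (2 * n) * (q_poch a (fps_X ^ 2) n * a)"
      by (simp add: q_poch_Suc algebra_simps flip: power_mult)
    with \<open>i < n\<close> show "q_poch a (fps_X ^ 2) (Suc n) $ i = q_poch a (fps_X ^ 2) n $ i"
      by (simp add: fps_X_power_mult_nth)
  qed
  then show ?thesis
    by (simp add: q_poch_inf_def convergent_LIMSEQ_iff)
qed

text \<open>A nonzero constant coefficient makes the infinite product a unit, so dividing by it is
  multiplying by its inverse.\<close>

lemma q_poch_inf_fps_nth_0: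
  fixes a :: "'a::comm_ring_1 fps"
  assumes "a $ 0 = 0"
  shows "q_poch_inf a (fps_X ^ 2) $ 0 = 1"
proof -
  have "\<forall>\<^sub>F n in sequentially. q_poch a (fps_X ^ 2) n $ 0 = q_poch_inf a (fps_X ^ 2) $ 0"
    using q_poch_LIMSEQ[of a] by (simp add: tendsto_fps_iff)
  then show ?thesis
    using q_poch_fps_nth_0[OF assms, of "fps_X ^ 2"] by (simp add: eventually_sequentially) auto
qed

section \<open>Partitions with prescribed multiplicities\<close>

text \<open>\<open>S\<close> holds the admissible parts, \<open>A k\<close> the admissible
  multiplicities of the part \<open>k\<close>.\<close>

definition partitions_in :: "(nat \<Rightarrow> nat set) \<Rightarrow> nat set \<Rightarrow> nat \<Rightarrow> nat multiset set" where
  "partitions_in A S n =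
     {p. set_mset p \<subseteq> S \<and> (\<forall>k\<in>S. count p k \<in> A k) \<and> sum_mset p = n}"

text \<open>For positive \<open>k\<close> this is the sum of \<open>fps_X ^ (k * a)\<close> over
  \<open>a \<in> A\<close>; the indicator form covers infinite \<open>A\<close> without a
  limit.\<close>

definition part_fps :: "nat set \<Rightarrow> nat \<Rightarrow> 'a::comm_ring_1 fps" where
  "part_fps A k = Abs_fps (\<lambda>n. of_bool (n \<in> (*) k ` A))"

lemma size_le_sum_mset:
  fixes p :: "nat multiset"
  assumes "0 \<notin># p"
  shows "size p \<le> sum_mset p"
  using assms by (induction p) auto

lemma le_sum_mset:
  fixes p :: "nat multiset"
  assumes "k \<in># p"
  shows "k \<le> sum_mset p"
  using assms by (auto dest!: multi_member_split)

text \<open>Since all parts are positive, there are at most \<open>n\<close> of them.\<close>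

lemma finite_partitions_in:
  assumes "finite S" and "0 \<notin> S"
  shows "finite (partitions_in A S n)"
proof (rule finite_subset)
  show "partitions_in A S n \<subseteq> mset ` {xs. set xs \<subseteq> S \<and> length xs \<le> n}"
  proof
    fix p
    assume p: "p \<in> partitions_in A S n"
    obtain xs where xs: "p = mset xs"
      by (metis ex_mset)
    have "size p \<le> n"
      using p size_le_sum_mset[of p] \<open>0 \<notin> S\<close> by (auto simp: partitions_in_def)
    then show "p \<in> mset ` {xs. set xs \<subseteq> S \<and> length xs \<le> n}"
      using p xs by (auto simp: partitions_in_def)
  qed
  show "finite (mset ` {xs. set xs \<subseteq> S \<and> length xs \<le> n})"
    using finite_lists_length_le[OF \<open>finite S\<close>] by auto
qed

text \<open>Deleting the \<open>a\<close> copies of \<open>k\<close> is a bijection. The slice is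
  indexed by the amount \<open>k * a\<close> that \<open>k\<close> contributes to the sum, because
  this is the summation index of the Cauchy product in \<open>prod_part_fps\<close>.\<close>

lemma card_partitions_in_insert_slice:
  assumes "k \<notin> S" and "a \<in> A k" and "k * a \<le> n" and "0 < k"
  shows "card {p \<in> partitions_in A (insert k S) n. k * count p k = k * a} =
    card (partitions_in A S (n - k * a))"
proof -
  let ?f = "\<lambda>p. p + replicate_mset a k" and ?g = "filter_mset (\<lambda>j. j \<noteq> k)"
  have 0: "count p k = 0" if "p \<in> partitions_in A S m" for p m
    using that \<open>k \<notin> S\<close> by (auto simp: partitions_in_def count_eq_zero_iff)
  have split: "?f (?g p) = p" if "count p k = a" for p
    using that by (auto intro!: multiset_eqI)
  have "bij_betw ?f (partitions_in A S (n - k * a))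
      {p \<in> partitions_in A (insert k S) n. k * count p k = k * a}"
  proof (rule bij_betw_byWitness[where f' = ?g])
    show "\<forall>p\<in>partitions_in A S (n - k * a). ?g (?f p) = p"
      using 0 by (auto intro!: multiset_eqI)
    show "\<forall>p\<in>{p \<in> partitions_in A (insert k S) n. k * count p k = k * a}. ?f (?g p) = p"
      using split \<open>0 < k\<close> by auto
    show "?f ` partitions_in A S (n - k * a)
        \<subseteq> {p \<in> partitions_in A (insert k S) n. k * count p k = k * a}"
    proof (rule image_subsetI)
      fix p
      assume p: "p \<in> partitions_in A S (n - k * a)"
      show "?f p \<in> {p \<in> partitions_in A (insert k S) n. k * count p k = k * a}"
        using p 0[OF p] assms
        by (auto simp: partitions_in_def sum_mset_replicate_mset split: if_splits)
    qed
    show "?g ` {p \<in> partitions_in A (insert k S) n. k * count p k = k * a}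
        \<subseteq> partitions_in A S (n - k * a)"
    proof (rule image_subsetI)
      fix p
      assume p: "p \<in> {p \<in> partitions_in A (insert k S) n. k * count p k = k * a}"
      then have "sum_mset (?f (?g p)) = n"
        using split \<open>0 < k\<close> by (auto simp: partitions_in_def)
      then have "sum_mset (?g p) = n - k * a"
        by (simp add: sum_mset_replicate_mset mult.commute)
      then show "?g p \<in> partitions_in A S (n - k * a)"
        using p \<open>k \<notin> S\<close> by (auto simp: partitions_in_def)
    qed
  qed
  then show ?thesis
    by (simp add: bij_betw_same_card)
qed

text \<open>Adjoining a part \<open>k\<close> multiplies the series by one factor: the Cauchy
  product sorts the partitions of \<open>n\<close> by the contribution \<open>i\<close> of
  \<open>k\<close>, and coefficient \<open>i\<close> of the factor tells whether that contribution
  is admissible.\<close>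

lemma prod_part_fps:
  assumes "finite S" and "0 \<notin> S"
  shows "(\<Prod>k\<in>S. part_fps (A k) k) =
    (Abs_fps (\<lambda>n. of_nat (card (partitions_in A S n))) :: 'a::comm_ring_1 fps)"
  using assms
proof (induction S rule: finite_induct)
  case empty
  have "partitions_in A {} n = (if n = 0 then {{#}} else {})" for n
    by (auto simp: partitions_in_def)
  then show ?case
    by (auto simp: fps_eq_iff)
next
  case (insert k S)
  show ?case
  proof (rule fps_ext)
    fix n
    let ?P = "\<lambda>i. {p \<in> partitions_in A (insert k S) n. k * count p k = i}"
    have slice: "card (?P i) = of_bool (i \<in> (*) k ` A k) * card (partitions_in A S (n - i))"
      if "i \<le> n" for i
    proof (cases "i \<in> (*) k ` A k")
      case True
      then show ?thesis
        using card_partitions_in_insert_slice[of k S _ A n] insert that by auto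
    next
      case False
      then have "?P i = {}"
        by (auto simp: partitions_in_def)
      with False show ?thesis
        by (simp only: card.empty) simp
    qed
    have "partitions_in A (insert k S) n = (\<Union>i\<in>{0..n}. ?P i)"
    proof (rule equalityI; rule subsetI)
      fix p
      assume p: "p \<in> partitions_in A (insert k S) n"
      \<comment> \<open>Splitting off the copies of \<open>k\<close> shows that they contribute at
        most \<open>n\<close>, so the slices \<open>0..n\<close> cover everything.\<close>
      have "p = filter_mset (\<lambda>j. j \<noteq> k) p + replicate_mset (count p k) k"
        by (auto intro!: multiset_eqI)
      then have "sum_mset p =
          sum_mset (filter_mset (\<lambda>j. j \<noteq> k) p) + count p k * k"
        by (metis sum_mset.union sum_mset_replicate_mset of_nat_id)
      then have "k * count p k \<le> sum_mset p"
        by (simp add: mult.commute)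
      with p show "p \<in> (\<Union>i\<in>{0..n}. ?P i)"
        by (auto simp: partitions_in_def)
    qed auto
    then have "card (partitions_in A (insert k S) n) = card (\<Union>i\<in>{0..n}. ?P i)"
      by simp
    also have "\<dots> = (\<Sum>i=0..n. card (?P i))"
      using finite_partitions_in[of "insert k S" A n] insert
      by (intro card_UN_disjoint) auto
    finally have "card (partitions_in A (insert k S) n) =
        (\<Sum>i=0..n. of_bool (i \<in> (*) k ` A k) * card (partitions_in A S (n - i)))"
      using slice by simp
    then show "(\<Prod>j\<in>insert k S. part_fps (A j) j) $ n =
        (Abs_fps (\<lambda>n. of_nat (card (partitions_in A (insert k S) n))) :: 'a fps) $ n"
      using insert by (simp add: fps_mult_nth part_fps_def)
  qed
qed

section \<open>Closed forms for the factor of a single part\<close>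

lemma part_fps_singleton: "part_fps {a} k = fps_X ^ (k * a)"
  by (auto simp: part_fps_def fps_eq_iff)

lemma part_fps_0_1:
  assumes "0 < k"
  shows "part_fps {0, 1} k = 1 + fps_X ^ k"
  using assms by (auto simp: part_fps_def fps_eq_iff)

lemma part_fps_UNIV:
  assumes "0 < k"
  shows "part_fps UNIV k = (inverse (1 - fps_X ^ k) :: 'a::field fps)"
proof -
  have "(part_fps UNIV k * (1 - fps_X ^ k)) $ n = (1 :: 'a fps) $ n" for n
  proof -
    \<comment> \<open>The multiples of \<open>k\<close> are invariant under a shift by
      \<open>k\<close>, so multiplying by \<open>1 - fps_X ^ k\<close> cancels every coefficient
      except the one at 0.\<close>
    have "n - k \<in> range ((*) k) \<longleftrightarrow> n \<in> range ((*) k)" if "k \<le> n"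
      using that dvd_minus_self[of k n] by (auto simp: image_iff dvd_def)
    moreover have "n \<notin> range ((*) k)" if "n < k" "n \<noteq> 0"
      using that by auto
    ultimately show ?thesis
      using assms by (auto simp: part_fps_def right_diff_distrib fps_X_power_mult_right_nth)
  qed
  then have "part_fps UNIV k * (1 - fps_X ^ k) = (1 :: 'a fps)"
    by (simp add: fps_eq_iff)
  then show ?thesis
    using assms by (metis fps_inverse_unique mult.commute)
qed

text \<open>One obligatory copy of \<open>k\<close> is set aside; the remaining multiplicity is
  arbitrary.\<close>

lemma part_fps_atLeast_1:
  "part_fps {1..} k = fps_X ^ k * (part_fps UNIV k :: 'a::comm_ring_1 fps)"
proof -
  have "n \<in> (*) k ` {1..} \<longleftrightarrow> k \<le> n \<and> n - k \<in> range ((*) k)" for n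
  proof
    assume "n \<in> (*) k ` {1..}"
    then obtain a where a: "n = k * a" "1 \<le> a"
      by auto
    then have "n - k = k * (a - 1)"
      by (simp add: diff_mult_distrib2)
    with a show "k \<le> n \<and> n - k \<in> range ((*) k)"
      by auto
  next
    assume "k \<le> n \<and> n - k \<in> range ((*) k)"
    then obtain b where "n = k * (b + 1)"
      by (auto simp: algebra_simps) (metis le_add_diff_inverse)
    then show "n \<in> (*) k ` {1..}"
      by (intro image_eqI[where x = "b + 1"]) auto
  qed
  then show ?thesis
    by (auto simp: fps_eq_iff part_fps_def fps_X_power_mult_nth)
qed

section \<open>Partitions without repeated even parts and with given mex\<close>

definition ed_mults :: "nat \<Rightarrow> nat \<Rightarrow> nat set" where
  "ed_mults m k =
     (if k < m then (if even k then {1} else {1..})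
      else if k = m then {0} else if even k then {0, 1} else UNIV)"

lemma mex_eq_iff:
  "mex p = m \<longleftrightarrow> 0 < m \<and> m \<notin># p \<and> (\<forall>k. 0 < k \<and> k < m \<longrightarrow> k \<in># p)"
proof -
  \<comment> \<open>A number exceeding the sum cannot be a part, so \<open>LEAST\<close> ranges over
    a nonempty set.\<close>
  have "0 < Suc (sum_mset p) \<and> Suc (sum_mset p) \<notin># p"
    using le_sum_mset[of "Suc (sum_mset p)" p] by auto
  then have "0 < mex p \<and> mex p \<notin># p"
    unfolding mex_def by (rule LeastI)
  moreover have "k \<in># p" if "0 < k" "k < mex p" for k
    using not_less_Least[of k "\<lambda>m. 0 < m \<and> m \<notin># p"] that by (auto simp: mex_def)
  ultimately show ?thesis
    by (metis linorder_neqE_nat)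
qed

lemma mex_pos: "0 < mex p"
  using mex_eq_iff[of p "mex p"] by simp

text \<open>If the mex is not 1, its predecessor is a part and hence at most \<open>n\<close>.
  Consequently only finitely many mex values affect a given coefficient.\<close>

lemma mex_le:
  assumes "p \<in> partitions_ed n"
  shows "mex p \<le> Suc n"
proof (cases "mex p = 1")
  case False
  then have "mex p - 1 \<in># p"
    using mex_eq_iff[of p "mex p"] by auto
  then show ?thesis
    using le_sum_mset[of "mex p - 1" p] assms by (auto simp: partitions_ed_def)
qed simp

lemma partitions_ed_part_bounds:
  assumes "p \<in> partitions_ed n" and "k \<in># p"
  shows "k \<in> {1..n}"
proof -
  have "0 \<notin># p" and "sum_mset p = n"
    using assms(1) by (simp_all add: partitions_ed_def)
  then show ?thesis
    using assms(2) le_sum_mset[OF assms(2)] by (cases k) auto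
qed

text \<open>No part exceeds \<open>n\<close>, and \<open>m \<le> N\<close> ensures that the
  conditions at and below \<open>m\<close> are all imposed. The freedom in \<open>N\<close> later
  allows truncation at any large bound.\<close>

lemma partitions_ed_mex_eq:
  assumes "n \<le> N" and "m \<le> N" and "0 < m"
  shows "{p \<in> partitions_ed n. mex p = m} = partitions_in (ed_mults m) {1..N} n"
proof (rule set_eqI)
  fix p
  show "p \<in> {p \<in> partitions_ed n. mex p = m} \<longleftrightarrow> p \<in> partitions_in (ed_mults m) {1..N} n"
  proof
    assume p: "p \<in> {p \<in> partitions_ed n. mex p = m}"
    have "k \<in> {1..N}" if "k \<in># p" for k
      using partitions_ed_part_bounds[of p n k] p that \<open>n \<le> N\<close> by auto
    then have "set_mset p \<subseteq> {1..N}"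
      by blast
    moreover have "count p k \<in> ed_mults m k" if "k \<in> {1..N}" for k
    proof -
      have "even k \<Longrightarrow> count p k \<le> 1" "k < m \<Longrightarrow> 0 < count p k" "k = m \<Longrightarrow> count p k = 0"
        using p that by (auto simp: partitions_ed_def mex_eq_iff count_eq_zero_iff)
      then show ?thesis
        by (cases "count p k") (auto simp: ed_mults_def)
    qed
    ultimately show "p \<in> partitions_in (ed_mults m) {1..N} n"
      using p by (simp add: partitions_in_def partitions_ed_def)
  next
    assume p: "p \<in> partitions_in (ed_mults m) {1..N} n"
    then have c: "count p k \<in> ed_mults m k" if "0 < k" "k \<le> N" for k
      using that by (auto simp: partitions_in_def)
    have z: "count p k = 0" if "k = 0 \<or> N < k" for k
      using p that by (auto simp: partitions_in_def count_eq_zero_iff)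
    have "count p k \<le> 1" if "even k" for k
      using c[of k] z[of k] that
      by (cases "k = 0 \<or> N < k") (auto simp: ed_mults_def split: if_splits)
    moreover have "m \<notin># p"
      using c[of m] assms by (simp add: ed_mults_def count_eq_zero_iff)
    moreover have "k \<in># p" if "0 < k" "k < m" for k
    proof -
      have "count p k \<noteq> 0"
        using c[of k] that assms by (intro notI) (auto simp: ed_mults_def split: if_splits)
      then show ?thesis
        by (metis not_in_iff)
    qed
    moreover have "0 \<notin># p"
      using z[of 0] by (simp add: count_eq_zero_iff)
    ultimately show "p \<in> {p \<in> partitions_ed n. mex p = m}"
      using p \<open>0 < m\<close> by (auto simp: partitions_ed_def mex_eq_iff partitions_in_def)
  qed
qed

lemma finite_partitions_ed: "finite (partitions_ed n)"
proof (rule finite_subset)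
  show "partitions_ed n \<subseteq> partitions_in (\<lambda>_. UNIV) {1..n} n"
  proof
    fix p
    assume p: "p \<in> partitions_ed n"
    have "set_mset p \<subseteq> {1..n}"
      using partitions_ed_part_bounds[OF p] by blast
    with p show "p \<in> partitions_in (\<lambda>_. UNIV) {1..n} n"
      by (simp add: partitions_ed_def partitions_in_def)
  qed
qed (simp add: finite_partitions_in)

section \<open>The generating function for a fixed mex\<close>

definition mex_fps :: "nat \<Rightarrow> 'a::field fps" where
  "mex_fps m = Abs_fps (\<lambda>n. of_nat (card {p \<in> partitions_ed n. mex p = m}))"

text \<open>The factor of the part \<open>k\<close> when the only restriction is that even parts are
  not repeated.\<close>

definition ed_factor :: "nat \<Rightarrow> 'a::field fps" where
  "ed_factor k = (if even k then 1 + fps_X ^ k else inverse (1 - fps_X ^ k))"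

text \<open>Truncating at the even bound \<open>2 * K\<close> gives both Pochhammer symbols exactly
  \<open>K\<close> factors; each induction step adds one odd and one even part.\<close>

lemma prod_ed_factor:
  "(\<Prod>k\<in>{1..2 * K}. ed_factor k) =
    q_poch (- (fps_X ^ 2)) (fps_X ^ 2) K * inverse (q_poch fps_X (fps_X ^ 2) K :: 'a::field fps)"
proof (induction K)
  case (Suc K)
  have "{1..2 * Suc K} = insert (2 * K + 1) (insert (2 * K + 2) {1..2 * K})"
    by auto
  then have "(\<Prod>k\<in>{1..2 * Suc K}. ed_factor k) =
      (1 + fps_X ^ (2 * K + 2)) * inverse (1 - fps_X ^ (2 * K + 1)) *
      (\<Prod>k\<in>{1..2 * K}. ed_factor k :: 'a fps)"
    by (simp add: ed_factor_def mult_ac)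
  then show ?case
    unfolding Suc q_poch_fps_X_Suc q_poch_neg_fps_X2_Suc fps_inverse_mult
    by (simp only: mult_ac)
qed (simp add: q_poch_def)

text \<open>The exponent is \<open>1 + 2 + ... + 2 * n\<close>, and the even parts supply the
  factors of the Pochhammer symbol.\<close>

lemma prod_below_mex:
  "(\<Prod>k\<in>{1..2 * n}. fps_X ^ k * (if even k then inverse (1 + fps_X ^ k) else 1)) =
    fps_X ^ (2 * n ^ 2 + n) * inverse (q_poch (- (fps_X ^ 2)) (fps_X ^ 2) n :: 'a::field fps)"
proof (induction n)
  case (Suc n)
  have "{1..2 * Suc n} = insert (2 * n + 1) (insert (2 * n + 2) {1..2 * n})"
    by auto
  moreover have e: "2 * Suc n ^ 2 + Suc n = (2 * n ^ 2 + n) + ((2 * n + 1) + (2 * n + 2))"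
    by (simp add: power2_eq_square)
  have "fps_X ^ (2 * Suc n ^ 2 + Suc n) =
      (fps_X ^ (2 * n ^ 2 + n) * (fps_X ^ (2 * n + 1) * fps_X ^ (2 * n + 2)) :: 'a fps)"
    unfolding e power_add by (rule refl)
  moreover have "inverse (q_poch (- (fps_X ^ 2)) (fps_X ^ 2) (Suc n)) =
      inverse (q_poch (- (fps_X ^ 2)) (fps_X ^ 2) n) * inverse (1 + fps_X ^ (2 * n + 2) :: 'a fps)"
    by (simp only: q_poch_neg_fps_X2_Suc fps_inverse_mult)
  ultimately show ?case
    using Suc by (simp add: mult_ac)
qed (simp add: q_poch_def)

text \<open>Relates the constrained factor to the unconstrained one by a correction that is 1 above
  \<open>m\<close>, so that only finitely many corrections remain in the product.\<close>

lemma part_fps_ed_mults: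
  assumes "0 < k"
  shows "part_fps (ed_mults m k) k =
    (ed_factor k :: 'a::field fps) *
      (if k < m then fps_X ^ k * (if even k then inverse (1 + fps_X ^ k) else 1)
       else if k = m then inverse (ed_factor m) else 1)"
proof -
  have "(1 + fps_X ^ k) * inverse (1 + fps_X ^ k :: 'a fps) = 1"
    using assms by (intro inverse_mult_eq_1') simp
  moreover have "ed_factor k * inverse (ed_factor k :: 'a fps) = 1"
    using assms by (intro inverse_mult_eq_1') (simp add: ed_factor_def)
  ultimately show ?thesis
    using assms
    by (auto simp: ed_mults_def ed_factor_def part_fps_singleton part_fps_0_1[simplified]
        part_fps_UNIV part_fps_atLeast_1[simplified] mult_ac)
qed

definition ed_prod :: "'a::field fps" where
  "ed_prod = q_poch_inf (- (fps_X ^ 2)) (fps_X ^ 2) / q_poch_inf fps_X (fps_X ^ 2)"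

text \<open>The truncated products \<open>?G\<close> have two limits that must agree: counting
  partitions coefficientwise gives \<open>mex_fps m\<close>, while separating the corrections from
  the factors \<open>ed_factor k\<close> gives \<open>ed_prod * ?D\<close>.\<close>

lemma mex_fps_eq:
  assumes "0 < m"
  shows "mex_fps m = ed_prod *
    ((\<Prod>k\<in>{1..<m}. fps_X ^ k * (if even k then inverse (1 + fps_X ^ k) else 1)) *
      inverse (ed_factor m) :: 'a::field fps)"
    (is "_ = ed_prod * ?D")
proof -
  let ?G = "\<lambda>K. (\<Prod>k\<in>{1..2 * K}. part_fps (ed_mults m k) k) :: 'a fps"
  have "?G \<longlonglongrightarrow> mex_fps m"
  proof (rule tendsto_fpsI)
    fix n
    have "?G K $ n = mex_fps m $ n" if "n + m \<le> K" for K
      using that assms prod_part_fps[of "{1..2 * K}" "ed_mults m", where 'a = 'a]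
      by (simp add: mex_fps_def partitions_ed_mex_eq[of n "2 * K" m])
    then show "\<forall>\<^sub>F K in sequentially. ?G K $ n = mex_fps m $ n"
      by (auto simp: eventually_sequentially)
  qed
  moreover have "?G \<longlonglongrightarrow> ed_prod * ?D"
  proof -
    have "(\<lambda>K. (\<Prod>k\<in>{1..2 * K}. ed_factor k)) \<longlonglongrightarrow> (ed_prod :: 'a fps)"
      unfolding prod_ed_factor ed_prod_def
      by (simp add: fps_divide_unit q_poch_inf_fps_nth_0)
        (intro tendsto_mult_fps q_poch_LIMSEQ tendsto_inverse_fps, simp add: q_poch_inf_fps_nth_0)
    then have "(\<lambda>K. (\<Prod>k\<in>{1..2 * K}. ed_factor k) * ?D) \<longlonglongrightarrow> ed_prod * ?D"
      by (intro tendsto_mult_fps tendsto_const)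
    moreover have "\<forall>\<^sub>F K in sequentially. (\<Prod>k\<in>{1..2 * K}. ed_factor k) * ?D = ?G K"
    proof (rule eventually_sequentiallyI)
      fix K
      assume "m \<le> K"
      let ?c = "\<lambda>k. (if k < m then fps_X ^ k * (if even k then inverse (1 + fps_X ^ k) else 1)
        else if k = m then inverse (ed_factor m) else 1) :: 'a fps"
      \<comment> \<open>Once the truncation includes \<open>m\<close>, the corrections beyond it are
        all 1 and the product no longer depends on \<open>K\<close>.\<close>
      have "prod ?c {1..2 * K} = prod ?c (insert m {1..<m})"
        by (rule prod.mono_neutral_right) (use \<open>m \<le> K\<close> assms in auto)
      also have "\<dots> = ?D"
        by (simp add: mult.commute)
      finally have "prod ?c {1..2 * K} = ?D" .
      moreover have "?G K = (\<Prod>k\<in>{1..2 * K}. ed_factor k * ?c k)"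
        by (intro prod.cong refl part_fps_ed_mults) simp
      ultimately show "(\<Prod>k\<in>{1..2 * K}. ed_factor k) * ?D = ?G K"
        by (simp add: prod.distrib)
    qed
    ultimately show ?thesis
      by (rule Lim_transform_eventually)
  qed
  ultimately show ?thesis
    by (rule LIMSEQ_unique)
qed

lemma q_poch_neg_fps_nth_0: "q_poch (- (fps_X ^ 2)) (fps_X ^ 2) n $ 0 = (1 :: 'a::field)"
  by (rule q_poch_fps_nth_0) simp

text \<open>For odd mex the cancelled factor leaves \<open>1 - fps_X ^ (2 * n + 1)\<close>, which
  produces the difference of two terms.\<close>

lemma mex_fps_odd:
  "mex_fps (2 * n + 1) = (ed_prod :: 'a::field fps) *
    (fps_X ^ (2 * n ^ 2 + n) / q_poch (- (fps_X ^ 2)) (fps_X ^ 2) n -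
     fps_X ^ ((2 * n + 1) * (n + 1)) / q_poch (- (fps_X ^ 2)) (fps_X ^ 2) n)"
proof -
  have "{1..<2 * n + 1} = {1..2 * n}"
    by auto
  then have m: "mex_fps (2 * n + 1) = (ed_prod :: 'a fps) *
      (fps_X ^ (2 * n ^ 2 + n) * inverse (q_poch (- (fps_X ^ 2)) (fps_X ^ 2) n) *
       inverse (ed_factor (2 * n + 1)))"
    using mex_fps_eq[of "2 * n + 1", where 'a = 'a] prod_below_mex[of n, where 'a = 'a] by simp
  have e: "(2 * n + 1) * (n + 1) = (2 * n ^ 2 + n) + (2 * n + 1)"
    by (simp add: power2_eq_square)
  have f: "inverse (ed_factor (2 * n + 1)) = (1 - fps_X ^ (2 * n + 1) :: 'a fps)"
    by (simp add: ed_factor_def)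
  have d: "g / q_poch (- (fps_X ^ 2)) (fps_X ^ 2) n =
      g * inverse (q_poch (- (fps_X ^ 2)) (fps_X ^ 2) n)" for g :: "'a fps"
    by (simp add: fps_divide_unit q_poch_neg_fps_nth_0)
  show ?thesis
    unfolding m f d e power_add[of _ "2 * n ^ 2 + n"] right_diff_distrib mult_1_right
    by (simp only: mult_ac)
qed

text \<open>Below \<open>2 * Suc n\<close> lies one more odd part, \<open>2 * n + 1\<close>, which
  raises the exponent; cancelling the factor at the even mex extends the Pochhammer symbol from
  \<open>n\<close> to \<open>Suc n\<close>.\<close>

lemma mex_fps_even:
  "mex_fps (2 * Suc n) = (ed_prod :: 'a::field fps) *
    (fps_X ^ (2 * Suc n ^ 2 - Suc n) / q_poch (- (fps_X ^ 2)) (fps_X ^ 2) (Suc n))"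
proof -
  have *: "{1..<2 * Suc n} = insert (2 * n + 1) {1..2 * n}"
    by auto
  have e: "2 * Suc n ^ 2 - Suc n = (2 * n ^ 2 + n) + (2 * n + 1)"
    by (simp add: power2_eq_square)
  have f: "inverse (ed_factor (2 * Suc n)) = inverse (1 + fps_X ^ (2 * Suc n) :: 'a fps)"
    by (simp add: ed_factor_def)
  have p: "inverse (q_poch (- (fps_X ^ 2)) (fps_X ^ 2) (Suc n)) =
    inverse (q_poch (- (fps_X ^ 2)) (fps_X ^ 2) n) * inverse (1 + fps_X ^ (2 * Suc n) :: 'a fps)"
    by (simp only: q_poch_neg_fps_X2_Suc fps_inverse_mult) simp
  have b: "(\<Prod>k\<in>{1..<2 * Suc n}. fps_X ^ k * (if even k then inverse (1 + fps_X ^ k) else 1)) =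
    fps_X ^ (2 * Suc n ^ 2 - Suc n) * inverse (q_poch (- (fps_X ^ 2)) (fps_X ^ 2) n :: 'a fps)"
    unfolding * e power_add[of _ "2 * n ^ 2 + n"]
    by (subst prod.insert) (simp_all only: prod_below_mex, simp_all add: mult_ac)
  have d: "g / q_poch (- (fps_X ^ 2)) (fps_X ^ 2) (Suc n) =
      g * inverse (q_poch (- (fps_X ^ 2)) (fps_X ^ 2) (Suc n))" for g :: "'a fps"
    by (simp add: fps_divide_unit q_poch_neg_fps_nth_0)
  have "mex_fps (2 * Suc n) = (ed_prod :: 'a fps) *
      (fps_X ^ (2 * Suc n ^ 2 - Suc n) * inverse (q_poch (- (fps_X ^ 2)) (fps_X ^ 2) n) *
       inverse (1 + fps_X ^ (2 * Suc n)))"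
    by (subst mex_fps_eq) (simp_all only: b f, simp)
  then show ?thesis
    unfolding d p by (simp only: mult.assoc)
qed

section \<open>Summation over the mex\<close>

lemma mex_fps_sums:
  assumes "inj f" and "\<And>j. j \<le> f j"
  shows "(\<lambda>j. mex_fps (f j)) sums
    (Abs_fps (\<lambda>n. of_nat (card {p \<in> partitions_ed n. mex p \<in> range f})) :: 'a::field fps)"
  unfolding sums_def
proof (rule tendsto_fpsI)
  fix n
  \<comment> \<open>The bound comes from \<open>j \<le> f j\<close> and mex at most
    \<open>n + 1\<close>: every index that contributes to coefficient \<open>n\<close> is below
    \<open>n + 2\<close>.\<close>
  have "(\<Sum>j<J. mex_fps (f j)) $ n =
      (of_nat (card {p \<in> partitions_ed n. mex p \<in> range f}) :: 'a)" if "n + 2 \<le> J" for J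
  proof -
    have "{p \<in> partitions_ed n. mex p \<in> range f} =
        (\<Union>j<J. {p \<in> partitions_ed n. mex p = f j})"
    proof (rule equalityI; rule subsetI)
      fix p
      assume "p \<in> {p \<in> partitions_ed n. mex p \<in> range f}"
      then obtain j where p: "p \<in> partitions_ed n" "mex p = f j"
        by blast
      have "j < J"
        using mex_le[OF p(1)] assms(2)[of j] that unfolding p(2) by linarith
      with p show "p \<in> (\<Union>j<J. {p \<in> partitions_ed n. mex p = f j})"
        by auto
    qed auto
    then have "card {p \<in> partitions_ed n. mex p \<in> range f} =
        card (\<Union>j<J. {p \<in> partitions_ed n. mex p = f j})"
      by simp
    also have "\<dots> = (\<Sum>j<J. card {p \<in> partitions_ed n. mex p = f j})"
      by (rule card_UN_disjoint) (auto simp: finite_partitions_ed inj_eq[OF \<open>inj f\<close>])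
    finally show ?thesis
      by (simp add: mex_fps_def fps_sum_nth)
  qed
  then show "\<forall>\<^sub>F J in sequentially. (\<Sum>j<J. mex_fps (f j)) $ n =
      (Abs_fps (\<lambda>n. of_nat (card {p \<in> partitions_ed n. mex p \<in> range f})) :: 'a fps) $ n"
    by (auto simp: eventually_sequentially)
qed

lemma summable_fps_X_power_div_q_poch:
  assumes "\<And>n. n \<le> e n"
  shows "summable (\<lambda>n. fps_X ^ e n / q_poch (- (fps_X ^ 2)) (fps_X ^ 2) (d n) :: 'a::field fps)"
  by (simp add: fps_divide_unit q_poch_neg_fps_nth_0 summable_fps_X_power_mult assms)

theorem theorem1p11:
  shows "let q = (fps_X :: rat fps) in
    Abs_fps (\<lambda>n. of_nat (a_ed_odd n)) =
      q_poch_inf (- (q ^ 2)) (q ^ 2) / q_poch_inf q (q ^ 2) *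
      ((\<Sum>n. q ^ (2 * n ^ 2 + n) / q_poch (- (q ^ 2)) (q ^ 2) n) -
       (\<Sum>n. q ^ ((2 * n + 1) * (n + 1)) / q_poch (- (q ^ 2)) (q ^ 2) n)) \<and>
    Abs_fps (\<lambda>n. of_nat (a_ed_even n)) =
      q_poch_inf (- (q ^ 2)) (q ^ 2) / q_poch_inf q (q ^ 2) *
      (\<Sum>n. q ^ (2 * Suc n ^ 2 - Suc n) / q_poch (- (q ^ 2)) (q ^ 2) (Suc n))"
  unfolding Let_def ed_prod_def[symmetric]
proof (rule conjI)
  let ?q = "fps_X :: rat fps"
  let ?Q = "q_poch (- (?q ^ 2)) (?q ^ 2)"
  have "mex p \<in> range (\<lambda>j. 2 * j + 1) \<longleftrightarrow> odd (mex p)" for p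
  proof
    assume "odd (mex p)"
    then obtain k where "mex p = 2 * k + 1"
      by (rule oddE)
    then show "mex p \<in> range (\<lambda>j. 2 * j + 1)"
      by (rule range_eqI)
  qed auto
  then have "(\<lambda>n. mex_fps (2 * n + 1)) sums Abs_fps (\<lambda>n. rat_of_nat (a_ed_odd n))"
    using mex_fps_sums[of "\<lambda>j. 2 * j + 1", where 'a = rat] by (simp add: a_ed_odd_def inj_def)
  \<comment> \<open>The same series is now summed through its closed-form terms; uniqueness of the
    sum yields the identity.\<close>
  moreover have "(\<lambda>n. mex_fps (2 * n + 1)) sums (ed_prod *
      ((\<Sum>n. ?q ^ (2 * n ^ 2 + n) / ?Q n) - (\<Sum>n. ?q ^ ((2 * n + 1) * (n + 1)) / ?Q n)))"
    unfolding mex_fps_odd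
    by (intro sums_mult_fps sums_diff_fps summable_sums summable_fps_X_power_div_q_poch) auto
  ultimately show "Abs_fps (\<lambda>n. of_nat (a_ed_odd n)) = ed_prod *
      ((\<Sum>n. ?q ^ (2 * n ^ 2 + n) / ?Q n) - (\<Sum>n. ?q ^ ((2 * n + 1) * (n + 1)) / ?Q n))"
    by (rule sums_unique2)
  \<comment> \<open>The mex is positive, so its even values start at 2; hence the shift to
    \<open>Suc j\<close>.\<close>
  have "mex p \<in> range (\<lambda>j. 2 * Suc j) \<longleftrightarrow> even (mex p)" for p
  proof
    assume "even (mex p)"
    then obtain k where "mex p = 2 * k"
      by (rule evenE)
    with mex_pos[of p] show "mex p \<in> range (\<lambda>j. 2 * Suc j)"
      by (cases k) auto
  qed auto
  then have "(\<lambda>n. mex_fps (2 * Suc n)) sums Abs_fps (\<lambda>n. rat_of_nat (a_ed_even n))"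
    using mex_fps_sums[of "\<lambda>j. 2 * Suc j", where 'a = rat] by (simp add: a_ed_even_def inj_def)
  moreover have "(\<lambda>n. mex_fps (2 * Suc n)) sums (ed_prod *
      (\<Sum>n. ?q ^ (2 * Suc n ^ 2 - Suc n) / ?Q (Suc n)))"
    unfolding mex_fps_even
    by (intro sums_mult_fps summable_sums summable_fps_X_power_div_q_poch)
      (simp add: power2_eq_square)
  ultimately show "Abs_fps (\<lambda>n. of_nat (a_ed_even n)) = ed_prod *
      (\<Sum>n. ?q ^ (2 * Suc n ^ 2 - Suc n) / ?Q (Suc n))"
    by (rule sums_unique2)
qed

end
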